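(* Let $G$ be a finite simple connected graph of order $n$, let $k\ge 0$ be an integer, and suppose that $G$ contains an isometric path $P=(x_0,x_1,\ldots,x_\ell)$, i.e. $d_G(x_i,x_j)=|i-j|$ for all $0\le i<j\le \ell$. Then $\mu_k(G)\le n-\ell+k+1$.
   Context: For $X\subseteq V(G)$ and an integer $k\ge 0$, two vertices $u,v\in V(G)$ are called $(X,k)$-visible if there exists a shortest $(u,v)$-path in $G$ having at most $k$ internal vertices that lie in $X$. A set $X\subseteq V(G)$ is a mutual $k$-visible set if every pair of distinct vertices of $X$ is $(X,k)$-visible. The mutual $k$-visibility number $\mu_k(G)$ is the maximum cardinality of a mutual $k$-visible set in $G$. *)

theory Defs
  imports "Graph_Theory.Graph_Theory"
begin

text \<open>
  A finite simple graph is a digraph in the locale \<^locale>\<open>graph\<close> of Graph_Theory (finite,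
  loop-free, no parallel arcs, symmetric arc relation): an undirected edge is a pair of
  opposite arcs, and a path is a list of arcs with pairwise distinct vertices.
\<close>

context wf_digraph
begin

text \<open>
  The library's constant \<open>\<mu>\<close> is the minimal cost of a walk under an arc weighting; with unit
  weights it is the distance. It is unrelated to the mutual visibility number.
\<close>

definition graph_dist :: "'a \<Rightarrow> 'a \<Rightarrow> ereal" where
  "graph_dist u v = \<mu> (\<lambda>_. 1) u v"

definition shortest_path :: "'a \<Rightarrow> 'b awalk \<Rightarrow> 'a \<Rightarrow> bool" where
  "shortest_path u p v \<longleftrightarrow> is_arg_min length (\<lambda>q. apath u q v) p"

definition isometric_path :: "'a vwalk \<Rightarrow> bool" where
  "isometric_path xs \<longleftrightarrow> vpath xs G \<and>
     (\<forall>i j. i < j \<and> j < length xs \<longrightarrow> graph_dist (xs ! i) (xs ! j) = ereal (real (j - i)))"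

definition internal_verts :: "'a \<Rightarrow> 'b awalk \<Rightarrow> 'a \<Rightarrow> 'a set" where
  "internal_verts u p v = set (awalk_verts u p) - {u, v}"

definition visible :: "'a set \<Rightarrow> nat \<Rightarrow> 'a \<Rightarrow> 'a \<Rightarrow> bool" where
  "visible X k u v \<longleftrightarrow>
     (\<exists>p. shortest_path u p v \<and> card (internal_verts u p v \<inter> X) \<le> k)"

definition mutual_visible_set :: "nat \<Rightarrow> 'a set \<Rightarrow> bool" where
  "mutual_visible_set k X \<longleftrightarrow>
     X \<subseteq> verts G \<and> (\<forall>u\<in>X. \<forall>v\<in>X. u \<noteq> v \<longrightarrow> visible X k u v)"

definition mutual_visibility_number :: "nat \<Rightarrow> nat" where
  "mutual_visibility_number k = Max {card X | X. mutual_visible_set k X}"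

end

end

theory Submission
  imports Defs
begin

text \<open>
  Let \<open>x\<^sub>a\<close> and \<open>x\<^sub>b\<close> be the first and the last vertex of the isometric path lying in a mutual
  \<open>k\<close>-visible set \<open>X\<close>, and let \<open>Q\<close> be a shortest path between them witnessing visibility.
  The \<open>a + (l - b)\<close> vertices of the isometric path before \<open>x\<^sub>a\<close> and after \<open>x\<^sub>b\<close> avoid \<open>X\<close>, and
  they avoid \<open>Q\<close> because they are too far from one of its ends. At least \<open>b - a - 1 - k\<close> of the
  internal vertices of \<open>Q\<close> also avoid \<open>X\<close>. So at least \<open>l - k - 1\<close> vertices lie outside \<open>X\<close>.
\<close>

context wf_digraph
begin

lemma awalk_cost_unit: "awalk_cost (\<lambda>_. 1) p = real (length p)"
  by (induction p) auto

lemma graph_dist_le_length: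
  assumes "awalk u p v"
  shows "graph_dist u v \<le> ereal (real (length p))"
  using min_cost_le_walk_cost[OF assms, of "\<lambda>_. 1"]
  by (simp add: graph_dist_def awalk_cost_unit)

end

context fin_digraph
begin

text \<open>\<open>graph_dist\<close> is an infimum over all walks, while
  \<open>shortest_path\<close> minimises over paths only. The two agree because, with nonnegative
  arc costs, the infimum is attained by a path.\<close>

lemma graph_dist_shortest_path:
  assumes "shortest_path u p v"
  shows "graph_dist u v = ereal (real (length p))"
proof -
  have p: "apath u p v" and min: "\<And>q. apath u q v \<Longrightarrow> length p \<le> length q"
    using assms by (auto simp: shortest_path_def is_arg_min_linorder)
  have "u \<rightarrow>\<^sup>* v"
    using p reachable_apath by blast
  then obtain q where "apath u q v" "graph_dist u v = ereal (real (length q))"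
    using min_cost_awalk[of u v "\<lambda>_. 1"] by (auto simp: graph_dist_def awalk_cost_unit)
  then show ?thesis
    using min[of q] graph_dist_le_length[OF awalkI_apath[OF p]] by simp
qed

text \<open>A path has one more vertex than arcs, and at most two of them are ends. Equality fails
  for the empty path, where the two ends coincide.\<close>

lemma card_internal_verts_ge:
  assumes "apath u p v"
  shows "length p \<le> card (internal_verts u p v) + 1"
proof -
  have "card (set (awalk_verts u p)) = Suc (length p)"
    using assms by (simp add: apath_def distinct_card length_awalk_verts)
  moreover have "card {u, v} \<le> 2"
    by (simp add: card_insert_if)
  ultimately show ?thesis
    using diff_card_le_card_Diff[of "{u, v}" "set (awalk_verts u p)"]
    by (simp add: internal_verts_def)
qed

lemma card_mutual_visible_set_le:
  assumes X: "mutual_visible_set k X" and xs: "isometric_path xs"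
  shows "card X + vwalk_length xs \<le> card (verts G) + k + 1"
proof -
  have XG: "X \<subseteq> verts G"
    using X by (simp add: mutual_visible_set_def)
  have finX: "finite X"
    using finite_subset[OF XG] by simp
  have dist: "distinct xs" and xsG: "set xs \<subseteq> verts G"
    using xs by (auto simp: isometric_path_def vpath_def vwalk_def)
  have gd: "graph_dist (xs ! i) (xs ! j) = ereal (real (j - i))" if "i < j" "j < length xs" for i j
    using xs that by (auto simp: isometric_path_def)
  define I where "I = {i. i < length xs \<and> xs ! i \<in> X}"
  have finI: "finite I"
    by (simp add: I_def)
  show ?thesis
  proof (cases "\<exists>i\<in>I. \<exists>j\<in>I. i < j")
    case True
    then obtain i j where ij: "i \<in> I" "j \<in> I" "i < j"
      by blast
    define a b where "a = Min I" and "b = Max I"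
    have "a \<in> I" "b \<in> I"
      using ij finI by (auto simp: a_def b_def intro!: Min_in Max_in)
    moreover have "a \<le> i" "j \<le> b"
      using ij finI by (auto simp: a_def b_def)
    ultimately have ab: "a < b" "b < length xs" "xs ! a \<in> X" "xs ! b \<in> X"
      using ij by (auto simp: I_def)
    have outside: "xs ! m \<notin> X" if "m < a \<or> b < m" "m < length xs" for m
    proof
      assume "xs ! m \<in> X"
      then have "m \<in> I"
        using that by (simp add: I_def)
      then have "a \<le> m" "m \<le> b"
        using finI by (auto simp: a_def b_def)
      then show False
        using that by auto
    qed
    have "xs ! a \<noteq> xs ! b"
      using ab dist by (simp add: nth_eq_iff_index_eq)
    then obtain p where p: "shortest_path (xs ! a) p (xs ! b)"
      and pk: "card (internal_verts (xs ! a) p (xs ! b) \<inter> X) \<le> k"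
      using X ab unfolding mutual_visible_set_def visible_def by blast
    have ap: "apath (xs ! a) p (xs ! b)"
      using p by (simp add: shortest_path_def is_arg_min_def)
    have len: "length p = b - a"
      using graph_dist_shortest_path[OF p] gd[OF ab(1,2)] by simp
    \<comment> \<open>Cut \<open>p\<close> at \<open>xs ! m\<close>. If \<open>m < a\<close>, the
      second piece has length at least \<open>b - m\<close>; if \<open>b < m\<close>, the first has
      length at least \<open>m - a\<close>. Either exceeds \<open>length p = b - a\<close>.\<close>
    have notin: "xs ! m \<notin> set (awalk_verts (xs ! a) p)" if m: "m < a \<or> b < m" "m < length xs" for m
    proof
      assume "xs ! m \<in> set (awalk_verts (xs ! a) p)"
      then obtain q r where qr: "p = q @ r" "awalk (xs ! a) q (xs ! m)" "awalk (xs ! m) r (xs ! b)"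
        using awalk_decomp[OF awalkI_apath[OF ap]] by blast
      show False
        using m(1)
      proof
        assume "m < a"
        then show False
          using graph_dist_le_length[OF qr(3)] gd[of m b] ab len qr(1) by simp
      next
        assume "b < m"
        then show False
          using graph_dist_le_length[OF qr(2)] gd[of a m] ab len qr(1) m(2) by simp
      qed
    qed
    define J A B where "J = {..<a} \<union> {b<..<length xs}" and "A = (!) xs ` J"
      and "B = internal_verts (xs ! a) p (xs ! b) - X"
    have "inj_on ((!) xs) J"
      using ab dist by (intro inj_on_nth) (auto simp: J_def)
    then have "card A = card J"
      by (simp add: A_def card_image)
    also have "\<dots> = a + (length xs - Suc b)"
      using ab unfolding J_def by (subst card_Un_disjoint) auto
    finally have cardA: "card A = a + (length xs - Suc b)" .
    have "card (internal_verts (xs ! a) p (xs ! b))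
        = card (internal_verts (xs ! a) p (xs ! b) \<inter> X) + card B"
      unfolding B_def by (subst card_Int_Diff[of _ X]) (simp_all add: internal_verts_def)
    \<comment> \<open>Kept additive because \<open>b - a - 1 - k\<close> would be truncated when
      \<open>k\<close> is large.\<close>
    then have cardB: "b - a \<le> card B + k + 1"
      using pk card_internal_verts_ge[OF ap] len by linarith
    have finA: "finite A" and finB: "finite B"
      by (simp_all add: A_def J_def B_def internal_verts_def)
    have J: "m < a \<or> b < m" "m < length xs" if "m \<in> J" for m
      using that ab by (auto simp: J_def)
    have AX: "A \<inter> X = {}"
      using outside J unfolding A_def by blast
    have AB: "A \<inter> B = {}"
      using notin J unfolding A_def B_def internal_verts_def by blast
    have "card (A \<union> B \<union> X) = card (A \<union> B) + card X"
      using finA finB finX AX by (intro card_Un_disjoint) (auto simp: B_def)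
    also have "card (A \<union> B) = card A + card B"
      using finA finB AB by (rule card_Un_disjoint)
    finally have "card (A \<union> B \<union> X) = card A + card B + card X" .
    moreover have "A \<subseteq> verts G"
      using xsG J(2) by (auto simp: A_def)
    moreover have "B \<subseteq> verts G"
      using awalkI_apath[OF ap] by (auto simp: B_def internal_verts_def)
    ultimately have "card A + card B + card X = card (A \<union> B \<union> X)" "A \<union> B \<union> X \<subseteq> verts G"
      using XG by simp_all
    moreover from this(2) have "card (A \<union> B \<union> X) \<le> card (verts G)"
      by (simp add: card_mono)
    \<comment> \<open>In the sum of \<open>cardA\<close> and \<open>cardB\<close> the indices
      \<open>a\<close> and \<open>b\<close> cancel, leaving
      \<open>length xs \<le> card A + card B + k + 2\<close>; \<open>vwalk_length xs\<close> is
      \<open>length xs - 1\<close>.\<close>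
    ultimately show ?thesis
      using cardA cardB ab by simp
  next
    \<comment> \<open>No two path vertices lie in \<open>X\<close>, so visibility says nothing here.
      Inclusion-exclusion for \<open>set xs\<close> and \<open>X\<close> alone gives
      \<open>card X + length xs \<le> card (verts G) + 1\<close>.\<close>
    case False
    then have "i = j" if "i \<in> I" "j \<in> I" for i j
      using that by (meson linorder_neqE_nat)
    then have "card I \<le> 1"
      using finI by (simp add: card_le_Suc0_iff_eq)
    moreover have "set xs \<inter> X = (!) xs ` I"
      by (auto simp: I_def in_set_conv_nth)
    ultimately have "card (set xs \<inter> X) \<le> 1"
      using card_image_le[OF finI, of "(!) xs"] by simp
    moreover have "card (set xs \<union> X) \<le> card (verts G)"
      using XG xsG by (simp add: card_mono)
    moreover have "card (set xs) = length xs"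
      using dist by (rule distinct_card)
    ultimately show ?thesis
      using card_Un_Int[of "set xs" X] finX by simp
  qed
qed

text \<open>\<open>Max\<close> is attained on a finite nonempty set: the sizes come from subsets of
  the finite vertex set, and the empty set is vacuously mutually visible.\<close>

lemma mutual_visibility_number_attained:
  obtains X where "mutual_visible_set k X" "mutual_visibility_number k = card X"
proof -
  let ?S = "{card X | X. mutual_visible_set k X}"
  have "?S \<subseteq> card ` Pow (verts G)"
    by (auto simp: mutual_visible_set_def)
  then have "finite ?S"
    by (rule finite_subset) simp
  moreover have "mutual_visible_set k {}"
    by (simp add: mutual_visible_set_def)
  then have "?S \<noteq> {}"
    by blast
  ultimately have "Max ?S \<in> ?S"
    by (rule Max_in)
  then show ?thesis
    using that by (auto simp: mutual_visibility_number_def)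
qed

end

theorem theorem3p11:
  fixes G :: "('a, 'b) pre_digraph" and n k l :: nat and xs :: "'a list"
  assumes "graph G"
    and "Digraph_Component.connected G"
    and "card (verts G) = n"
    and "wf_digraph.isometric_path G xs"
    and "vwalk_length xs = l"
  shows "int (wf_digraph.mutual_visibility_number G k) \<le> int n - int l + int k + 1"
proof -
  interpret graph G
    by (rule assms(1))
  obtain X where "mutual_visible_set k X" "mutual_visibility_number k = card X"
    by (rule mutual_visibility_number_attained)
  then show ?thesis
    using card_mutual_visible_set_le[OF _ assms(4), of k X] assms(3,5) by linarith
qed

end
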